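(* Assume that the second-stage problem has complete recourse and dual strict feasibility (as defined in the context). Let $\Xi=\{\xi\in\mathbb R^k: l_j\le\xi_j\le u_j,\ j=1,\dots,k\}$ be nonempty, closed and convex, where the $l_j$ and $u_j$ lie on the extended real line. Let $p=1$, i.e. the norm used is the $l_1$-norm. Let $x\in\mathbb R^{n_x}$, $\zeta^1,\dots,\zeta^N\in\Xi$, $\lambda\ge0$ and $i\in\{1,\dots,N\}$. If the problem $$\sup_{\xi\in\Xi}\; Z(x,\xi)-\lambda\|\xi-\zeta^i\|_1$$ has a finite optimum, then it has an optimal solution $\xi^*$ such that, for each $j\in\{1,\dots,k\}$, $\xi^*_j\in\partial[l_j,u_j]$ or $\xi^*_j=\zeta^i_j$.
   Context: $\mathcal K_y\subseteq\mathbb R^{n_y}$ is a Cartesian product of proper cones, with dual cone $\mathcal K_y^*$. $h:\mathbb R^{n_x}\to\mathbb R^{m_y}$ and $T:\mathbb R^{n_x}\to\mathbb R^{m_y\times k}$ are affine mappings; $q\in\mathbb R^{n_y}$ and $W\in\mathbb R^{m_y\times n_y}$. The second-stage cost is $$Z(x,\xi)=\inf_{y\in\mathcal K_y}\{q^Ty: Wy\ge h(x)+T(x)\xi\},$$ with dual $\sup_{\pi\in\Pi}(h(x)+T(x)\xi)^T\pi$, where $\Pi=\{\pi\ge 0: q-W^T\pi\in\mathcal K_y^*\}$. Complete recourse: for every right-hand side vector of the affine constraints in the second-stage problem (i.e. every vector in place of $h(x)+T(x)\xi$), the second-stage problem is feasible. Dual strict feasibility: the dual problem is feasible and has an interior point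 (strictly feasible point). $\partial[l_j,u_j]$ denotes the boundary in $\mathbb R$ of the interval $\{t\in\mathbb R: l_j\le t\le u_j\}$, i.e. the set of its finite endpoints. *)

theory Defs
  imports "HOL-Analysis.Analysis" "HOL-Library.Disjoint_Sets"
begin

text \<open>
  The factors of a product cone live in coordinate subspaces of \<open>real ^ 'n\<close>, so properness is
  stated relative to a subspace \<open>S\<close>; in particular, the interior is the one relative to \<open>S\<close>.
\<close>

definition proper_cone_in :: "('a::real_normed_vector) set \<Rightarrow> 'a set \<Rightarrow> bool" where
  "proper_cone_in S C \<longleftrightarrow>
     C \<subseteq> S \<and> cone C \<and> convex C \<and> closed C \<and>
     (\<forall>x. x \<in> C \<and> - x \<in> C \<longrightarrow> x = 0) \<and>
     top_of_set S interior_of C \<noteq> {}"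

definition coord_subspace :: "'n set \<Rightarrow> (real ^ 'n) set" where
  "coord_subspace B = {y. \<forall>i. i \<notin> B \<longrightarrow> y $ i = 0}"

definition coord_proj :: "'n set \<Rightarrow> real ^ 'n \<Rightarrow> real ^ 'n" where
  "coord_proj B y = (\<chi> i. if i \<in> B then y $ i else 0)"

text \<open>
  The index set is partitioned into blocks \<open>B\<close>, each carrying a proper cone \<open>C B\<close> in the
  coordinate subspace of \<open>B\<close> (a copy of the Euclidean space of dimension \<open>card B\<close>).
\<close>

definition product_of_proper_cones :: "(real ^ 'n) set \<Rightarrow> bool" where
  "product_of_proper_cones K \<longleftrightarrow>
     (\<exists>P C. partition_on UNIV P \<and>
        (\<forall>B\<in>P. proper_cone_in (coord_subspace B) (C B)) \<and>
        K = {y. \<forall>B\<in>P. coord_proj B y \<in> C B})"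

definition dual_cone :: "('a::real_inner) set \<Rightarrow> 'a set" where
  "dual_cone K = {z. \<forall>y\<in>K. 0 \<le> z \<bullet> y}"

definition affine_map :: "('a::real_vector \<Rightarrow> 'b::real_vector) \<Rightarrow> bool" where
  "affine_map f \<longleftrightarrow> (\<exists>L c. linear L \<and> f = (\<lambda>x. L x + c))"

text \<open>
  The order on \<open>real ^ 'm\<close> is the componentwise one. The value is \<open>\<infinity>\<close> if the problem is
  infeasible and \<open>- \<infinity>\<close> if it is unbounded.
\<close>

definition second_stage_cost ::
  "(real ^ 'n) set \<Rightarrow> real ^ 'n \<Rightarrow> real ^ 'n ^ 'm \<Rightarrow> ('x \<Rightarrow> real ^ 'm) \<Rightarrow>
   ('x \<Rightarrow> real ^ 'k ^ 'm) \<Rightarrow> 'x \<Rightarrow> real ^ 'k \<Rightarrow> ereal" where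
  "second_stage_cost K q W h T x \<xi> =
     (INF y \<in> {y \<in> K. W *v y \<ge> h x + T x *v \<xi>}. ereal (q \<bullet> y))"

definition complete_recourse :: "(real ^ 'n) set \<Rightarrow> real ^ 'n ^ 'm \<Rightarrow> bool" where
  "complete_recourse K W \<longleftrightarrow> (\<forall>r. \<exists>y\<in>K. W *v y \<ge> r)"

definition dual_feasible_set ::
  "(real ^ 'n) set \<Rightarrow> real ^ 'n \<Rightarrow> real ^ 'n ^ 'm \<Rightarrow> (real ^ 'm) set" where
  "dual_feasible_set K q W = {\<pi>. \<pi> \<ge> 0 \<and> q - transpose W *v \<pi> \<in> dual_cone K}"

text \<open>
  An interior point is a point in the topological interior of the feasible set. This is implied
  by the conic Slater condition, see \<open>dual_strict_feasibility_if_Slater\<close>.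
\<close>

definition dual_strict_feasibility ::
  "(real ^ 'n) set \<Rightarrow> real ^ 'n \<Rightarrow> real ^ 'n ^ 'm \<Rightarrow> bool" where
  "dual_strict_feasibility K q W \<longleftrightarrow>
     dual_feasible_set K q W \<noteq> {} \<and> interior (dual_feasible_set K q W) \<noteq> {}"

lemma dual_strict_feasibility_if_Slater:
  fixes W :: "real ^ 'n ^ 'm"
  assumes pos: "\<And>i. 0 < \<pi> $ i"
    and int: "q - transpose W *v \<pi> \<in> interior (dual_cone K)"
  shows "dual_strict_feasibility K q W"
proof -
  let ?S = "{\<pi>. \<forall>i. 0 < \<pi> $ i} \<inter> (\<lambda>\<pi>. q - transpose W *v \<pi>) -` interior (dual_cone K)"
  have "open {\<pi> :: real ^ 'm. \<forall>i. 0 < \<pi> $ i}"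
    unfolding Collect_all_eq by (intro open_INT ballI open_Collect_less continuous_intros) auto
  moreover have "open ((\<lambda>\<pi>. q - transpose W *v \<pi>) -` interior (dual_cone K))"
    by (intro open_vimage continuous_intros matrix_vector_mult_linear_continuous_on) auto
  ultimately have "open ?S"
    by blast
  moreover have "?S \<subseteq> dual_feasible_set K q W"
    using interior_subset by (fastforce simp: dual_feasible_set_def less_eq_vec_def less_imp_le)
  ultimately have "?S \<subseteq> interior (dual_feasible_set K q W)"
    by (rule interior_maximal[rotated])
  then have "\<pi> \<in> interior (dual_feasible_set K q W)"
    using assms by blast
  then show ?thesis
    using interior_subset unfolding dual_strict_feasibility_def by blast
qed

definition box_set :: "('k \<Rightarrow> ereal) \<Rightarrow> ('k \<Rightarrow> ereal) \<Rightarrow> (real ^ 'k) set" where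
  "box_set l u = {\<xi>. \<forall>j. l j \<le> ereal (\<xi> $ j) \<and> ereal (\<xi> $ j) \<le> u j}"

definition l1_norm :: "real ^ 'k \<Rightarrow> real" where
  "l1_norm v = (\<Sum>j\<in>UNIV. \<bar>v $ j\<bar>)"

end

theory Submission
  imports Defs
begin

text \<open>
  Complete recourse and weak duality make \<open>Z(x, \<cdot>)\<close> a real-valued convex function. On either side
  of \<open>\<zeta>\<^sub>j\<close> the penalty is affine in the \<open>j\<close>-th coordinate, so there the objective is convex in
  that coordinate. A convex function on a bounded interval is dominated by its values at the end
  points, and one that is bounded above on a ray by its value at the origin of the ray. Hence the
  coordinates can be moved one after the other to \<open>\<zeta>\<^sub>j\<close> or to a finite bound without decreasing
  the objective. Only finitely many points arise in this way, and the best of them is optimal.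
\<close>

subsection \<open>Convex functions\<close>

lemma convex_on_eq:
  assumes "convex_on S f" and "\<And>x. x \<in> S \<Longrightarrow> f x = g x"
  shows "convex_on S g"
proof (rule convex_onI)
  show "convex S"
    using assms(1) by (rule convex_on_imp_convex)
  fix t :: real and x y
  assume *: "0 < t" "t < 1" "x \<in> S" "y \<in> S"
  then have "(1 - t) *\<^sub>R x + t *\<^sub>R y \<in> S"
    using \<open>convex S\<close> by (intro convexD) auto
  then show "g ((1 - t) *\<^sub>R x + t *\<^sub>R y) \<le> (1 - t) * g x + t * g y"
    using convex_onD[OF assms(1), of t x y] * by (simp add: assms(2))
qed

text \<open>Affinity of \<open>g\<close> enters as preservation of two-point combinations, so no
  linear part has to be exhibited when \<open>g\<close> moves one coordinate of a vector.\<close>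

lemma convex_on_compose_affine_combination:
  assumes "convex_on UNIV f" "convex S"
    and "\<And>t x y. g ((1 - t) *\<^sub>R x + t *\<^sub>R y) = (1 - t) *\<^sub>R g x + t *\<^sub>R g y"
  shows "convex_on S (\<lambda>x. f (g x))"
proof (rule convex_onI)
  fix t :: real and x y
  assume "0 < t" "t < 1"
  then show "f (g ((1 - t) *\<^sub>R x + t *\<^sub>R y)) \<le> (1 - t) * f (g x) + t * f (g y)"
    unfolding assms(3) by (intro convex_onD[OF assms(1)]) auto
qed fact

text \<open>If \<open>f t\<close> exceeded \<open>f c\<close>, convexity would force growth beyond
  \<open>t\<close> at least along the secant through \<open>c\<close> and \<open>t\<close>, hence
  past every bound.\<close>

lemma convex_on_ray_bounded_above_le:
  fixes f :: "real \<Rightarrow> real"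
  assumes conv: "convex_on {c..} f" and bdd: "bdd_above (f ` {c..})" and "c \<le> t"
  shows "f t \<le> f c"
proof (rule ccontr)
  assume "\<not> f t \<le> f c"
  then have less: "f c < f t" and "c < t"
    using \<open>c \<le> t\<close> by (cases "c = t"; force)+
  obtain M where M: "\<And>s. c \<le> s \<Longrightarrow> f s \<le> M"
    using bdd unfolding bdd_above_def by auto
  \<comment> \<open>The factor for which the secant, followed to the point \<open>s\<close> at
    \<open>n\<close> times the distance of \<open>t\<close> from \<open>c\<close>, rises by
    \<open>f t - f c\<close> more than the room \<open>M - f c\<close>.\<close>
  define n where "n = 1 + (M - f c) / (f t - f c)"
  have "f t \<le> M" using M \<open>c \<le> t\<close> by blast
  then have "n \<ge> 1" "n > 0" using less by (auto simp: n_def add_pos_nonneg)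
  define s where "s = c + n * (t - c)"
  have "c \<le> s" using \<open>n > 0\<close> \<open>c < t\<close> by (simp add: s_def)
  have t_eq: "(1 - 1/n) *\<^sub>R c + (1/n) *\<^sub>R s = t"
    using \<open>n > 0\<close> by (simp add: s_def field_simps)
  have "f ((1 - 1/n) *\<^sub>R c + (1/n) *\<^sub>R s) \<le> (1 - 1/n) * f c + (1/n) * f s"
    using \<open>n \<ge> 1\<close> \<open>c \<le> s\<close> by (intro convex_onD[OF conv]) auto
  then have "f t \<le> (1 - 1/n) * f c + (1/n) * f s"
    unfolding t_eq .
  then have "n * (f t - f c) \<le> f s - f c"
    using \<open>n > 0\<close> by (simp add: field_simps)
  moreover have "n * (f t - f c) = (f t - f c) + (M - f c)"
    using less by (simp add: n_def field_simps)
  ultimately show False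
    using M[OF \<open>c \<le> s\<close>] less by linarith
qed

section \<open>Boundary points of intervals with extended real bounds\<close>

lemma mem_frontier_ereal_interval:
  assumes "l \<le> ereal t" "ereal t \<le> u" and "l = ereal t \<or> u = ereal t"
  shows "t \<in> frontier {t. l \<le> ereal t \<and> ereal t \<le> u}" (is "t \<in> frontier ?S")
proof -
  have "t \<notin> interior ?S"
  proof
    assume "t \<in> interior ?S"
    then obtain e where "e > 0" and e: "cball t e \<subseteq> ?S"
      unfolding mem_interior_cball by blast
    \<comment> \<open>Both neighbours are needed, since either bound may be the one attained at
      \<open>t\<close>.\<close>
    then have "t - e \<in> cball t e" "t + e \<in> cball t e"
      by (auto simp: dist_real_def)
    then have "t - e \<in> ?S" "t + e \<in> ?S"
      using e by blast+
    then show False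
      using assms(3) \<open>e > 0\<close> by auto
  qed
  moreover have "t \<in> closure ?S"
    using assms by (intro subsetD[OF closure_subset]) simp
  ultimately show ?thesis
    by (simp add: frontier_def)
qed

lemma finite_frontier_ereal_interval:
  "finite (frontier {t. l \<le> ereal t \<and> ereal t \<le> u})" (is "finite (frontier ?S)")
proof (rule finite_subset)
  have "closed ?S"
    by (intro closed_Collect_conj closed_Collect_le continuous_intros)
  have "{t. l < ereal t \<and> ereal t < u} \<subseteq> interior ?S"
    by (intro interior_maximal open_Collect_conj open_Collect_less continuous_intros) auto
  \<comment> \<open>An infinite bound contributes the spurious point 0 here, which is harmless for
    finiteness.\<close>
  then show "frontier ?S \<subseteq> {real_of_ereal l, real_of_ereal u}"
    using \<open>closed ?S\<close>
    by (auto simp: frontier_def order.strict_iff_order)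
qed simp

text \<open>For finite \<open>u\<close> the maximum over \<open>{c..u}\<close> is at an end point;
  for infinite \<open>u\<close> the ray lemma gives \<open>c\<close>. Convexity is asked only to the
  right of \<open>c\<close> because the penalty has a concave kink there.\<close>

lemma convex_interval_dominated_by_frontier_right:
  fixes f :: "real \<Rightarrow> real" and l u :: ereal
  defines "S \<equiv> {t. l \<le> ereal t \<and> ereal t \<le> u}"
  assumes "c \<in> S" "t \<in> S" "c \<le> t"
    and conv: "convex_on (S \<inter> {c..}) f" and bdd: "bdd_above (f ` S)"
  shows "\<exists>s\<in>S. f t \<le> f s \<and> (s \<in> frontier S \<or> s = c)"
proof (cases u)
  case (real b)
  have b: "c \<le> b" "t \<le> b" "l \<le> ereal b"
    using assms(2,3) order_trans[of l "ereal t" "ereal b"] by (auto simp: S_def real)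
  then have "b \<in> S" by (simp add: S_def real)
  have "b \<in> frontier S"
    using b unfolding S_def by (intro mem_frontier_ereal_interval) (auto simp: real)
  have "convex_on {c..b} f"
    using \<open>c \<in> S\<close> by (intro convex_on_subset[OF conv]) (auto simp: S_def real intro: order_trans)
  then have "f t \<le> max (f c) (f b)"
    using convex_on_le_max[of c b f t] \<open>c \<le> t\<close> b by simp
  then show ?thesis
    using \<open>c \<in> S\<close> \<open>b \<in> S\<close> \<open>b \<in> frontier S\<close> by (auto simp: le_max_iff_disj)
next
  case PInf
  then have "{c..} \<subseteq> S"
    using \<open>c \<in> S\<close> by (auto simp: S_def intro: order_trans)
  then have "f t \<le> f c"
    using \<open>c \<le> t\<close>
    by (intro convex_on_ray_bounded_above_le[OF convex_on_subset[OF conv] bdd_above_mono[OF bdd]]) auto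
  then show ?thesis using \<open>c \<in> S\<close> by blast
next
  case MInf
  then show ?thesis using \<open>c \<in> S\<close> by (simp add: S_def)
qed

text \<open>Points left of \<open>c\<close> are handled by the reflection \<open>t\<close> to
  \<open>- t\<close>, which turns \<open>[l, u]\<close> into \<open>[- u, - l]\<close> and left into
  right.\<close>

lemma convex_interval_dominated_by_frontier:
  fixes f :: "real \<Rightarrow> real" and l u :: ereal
  defines "S \<equiv> {t. l \<le> ereal t \<and> ereal t \<le> u}"
  assumes "c \<in> S" "t \<in> S"
    and right: "convex_on (S \<inter> {c..}) f" and left: "convex_on (S \<inter> {..c}) f"
    and bdd: "bdd_above (f ` S)"
  shows "\<exists>s\<in>S. f t \<le> f s \<and> (s \<in> frontier S \<or> s = c)"
proof (cases "c \<le> t")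
  case True
  then show ?thesis
    using assms convex_interval_dominated_by_frontier_right by blast
next
  case False
  define S' where "S' = {t. - u \<le> ereal t \<and> ereal t \<le> - l}"
  have S': "S' = uminus ` S"
  proof (intro set_eqI iffI)
    fix t assume "t \<in> S'"
    then have "- t \<in> S"
      using ereal_minus_le_minus[of "- l" "ereal t"] ereal_minus_le_minus[of "ereal t" "- u"]
      by (simp add: S_def S'_def)
    then show "t \<in> uminus ` S" by force
  next
    fix t assume "t \<in> uminus ` S"
    then show "t \<in> S'"
      by (auto simp: S_def S'_def simp flip: uminus_ereal.simps(1))
  qed
  \<comment> \<open>For closed sets the frontier is the set minus its interior, and both commute
    with negation.\<close>
  have "closed S" "closed S'"
    unfolding S_def S'_def by (intro closed_Collect_conj closed_Collect_le continuous_intros)+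
  then have fr: "frontier S' = uminus ` frontier S"
    by (simp add: frontier_def S' interior_negations image_set_diff)
  have cv: "convex_on (S' \<inter> {- c..}) (\<lambda>s. f (- s))"
  proof (rule convex_onI)
    show "convex (S' \<inter> {- c..})"
      using convex_negations[OF convex_on_imp_convex[OF left]]
      by (auto simp: S' elim!: back_subst[of convex])
    fix r x y :: real
    assume "0 < r" "r < 1" "x \<in> S' \<inter> {- c..}" "y \<in> S' \<inter> {- c..}"
    then show "f (- ((1 - r) *\<^sub>R x + r *\<^sub>R y)) \<le> (1 - r) * f (- x) + r * f (- y)"
      using convex_onD[OF left, of r "- x" "- y"] by (auto simp: S')
  qed
  have "\<exists>s\<in>S'. f (- (- t)) \<le> f (- s) \<and> (s \<in> frontier S' \<or> s = - c)"
    unfolding S'_def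
    by (rule convex_interval_dominated_by_frontier_right[of "- c" _ _ "- t"])
      (use False assms(2,3) bdd cv in \<open>auto simp flip: S'_def simp: S' image_image\<close>)
  then show ?thesis
    unfolding fr unfolding S' by auto
qed

subsection \<open>Maximisation over boxes\<close>

text \<open>Induction over the coordinates already settled: moving coordinate \<open>j\<close>
  leaves the others as they are, and the box constrains each coordinate separately, so the
  one-dimensional lemma applies to each in turn.\<close>

lemma coordinatewise_convex_box_dominated:
  fixes F :: "real ^ 'k \<Rightarrow> real" and l u :: "'k \<Rightarrow> ereal" and c :: "real ^ 'k"
  defines "S j \<equiv> {t. l j \<le> ereal t \<and> ereal t \<le> u j}"
  assumes c: "c \<in> box_set l u" and bdd: "bdd_above (F ` box_set l u)"
    and right: "\<And>j \<xi>. convex_on {c $ j..} (\<lambda>t. F (\<chi> k. if k = j then t else \<xi> $ k))"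
    and left: "\<And>j \<xi>. convex_on {..c $ j} (\<lambda>t. F (\<chi> k. if k = j then t else \<xi> $ k))"
    and "finite J" "\<xi> \<in> box_set l u"
  shows "\<exists>\<xi>'\<in>box_set l u. F \<xi> \<le> F \<xi>' \<and> (\<forall>j\<in>J. \<xi>' $ j \<in> frontier (S j) \<or> \<xi>' $ j = c $ j)"
  using \<open>finite J\<close>
proof induction
  case empty
  then show ?case using \<open>\<xi> \<in> box_set l u\<close> by auto
next
  case (insert j J)
  then obtain \<eta> where \<eta>: "\<eta> \<in> box_set l u" "F \<xi> \<le> F \<eta>"
    "\<forall>j\<in>J. \<eta> $ j \<in> frontier (S j) \<or> \<eta> $ j = c $ j"
    by blast
  define upd where "upd t = (\<chi> k. if k = j then t else \<eta> $ k)" for t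
  have upd_same: "upd (\<eta> $ j) = \<eta>"
    by (simp add: upd_def vec_eq_iff)
  have upd_box: "upd t \<in> box_set l u" if "t \<in> S j" for t
    using \<eta>(1) that by (simp add: upd_def box_set_def S_def)
  have "is_interval (S j)"
    unfolding is_interval_1 S_def
    by (metis (mono_tags, lifting) ereal_less_eq(3) mem_Collect_eq order_trans)
  then have "convex (S j)"
    by (simp add: is_interval_convex_1)
  then have "convex_on (S j \<inter> {c $ j..}) (\<lambda>t. F (upd t))"
    unfolding upd_def by (intro convex_on_subset[OF right]) (auto simp: convex_Int)
  moreover have "convex_on (S j \<inter> {..c $ j}) (\<lambda>t. F (upd t))"
    unfolding upd_def using \<open>convex (S j)\<close>
    by (intro convex_on_subset[OF left]) (auto simp: convex_Int)
  moreover have "bdd_above ((\<lambda>t. F (upd t)) ` S j)"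
    by (rule bdd_above_mono[OF bdd]) (use upd_box in auto)
  moreover have "c $ j \<in> S j" "\<eta> $ j \<in> S j"
    using c \<eta>(1) by (auto simp: box_set_def S_def)
  ultimately have "\<exists>s\<in>S j. F (upd (\<eta> $ j)) \<le> F (upd s) \<and> (s \<in> frontier (S j) \<or> s = c $ j)"
    unfolding S_def by (intro convex_interval_dominated_by_frontier) auto
  then obtain s where s: "s \<in> S j" "F \<eta> \<le> F (upd s)" "s \<in> frontier (S j) \<or> s = c $ j"
    unfolding upd_same by blast
  have "\<forall>k\<in>insert j J. upd s $ k \<in> frontier (S k) \<or> upd s $ k = c $ k"
    using \<eta>(3) s(3) by (auto simp: upd_def)
  then show ?case
    using upd_box[OF s(1)] \<eta>(2) s(2) by (meson order_trans)
qed

text \<open>Every point of the box is dominated by one of the finitely many candidates in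
  \<open>V\<close>, so a best candidate is a maximiser; attainment needs no compactness.\<close>

lemma coordinatewise_convex_box_maximum:
  fixes F :: "real ^ 'k \<Rightarrow> real" and l u :: "'k \<Rightarrow> ereal" and c :: "real ^ 'k"
  defines "S j \<equiv> {t. l j \<le> ereal t \<and> ereal t \<le> u j}"
  assumes c: "c \<in> box_set l u" and bdd: "bdd_above (F ` box_set l u)"
    and right: "\<And>j \<xi>. convex_on {c $ j..} (\<lambda>t. F (\<chi> k. if k = j then t else \<xi> $ k))"
    and left: "\<And>j \<xi>. convex_on {..c $ j} (\<lambda>t. F (\<chi> k. if k = j then t else \<xi> $ k))"
  shows "\<exists>\<xi>'\<in>box_set l u. (\<forall>\<xi>\<in>box_set l u. F \<xi> \<le> F \<xi>') \<and>
    (\<forall>j. \<xi>' $ j \<in> frontier (S j) \<or> \<xi>' $ j = c $ j)"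
proof -
  define V where "V = {\<xi> \<in> box_set l u. \<forall>j. \<xi> $ j \<in> frontier (S j) \<or> \<xi> $ j = c $ j}"
  have dom: "\<exists>\<xi>'\<in>V. F \<xi> \<le> F \<xi>'" if "\<xi> \<in> box_set l u" for \<xi>
    using coordinatewise_convex_box_dominated[OF c bdd right left finite that, of UNIV]
    by (auto simp: V_def S_def)
  \<comment> \<open>Each candidate picks every coordinate from a finite set, so the candidates embed
    in a finite product.\<close>
  let ?P = "\<Pi>\<^sub>E j\<in>UNIV. insert (c $ j) (frontier (S j))"
  have "\<xi> \<in> vec_lambda ` ?P" if "\<xi> \<in> V" for \<xi>
    using that by (intro image_eqI[of _ _ "($) \<xi>"]) (auto simp: V_def)
  moreover have "finite ?P"
    by (intro finite_PiE) (simp_all add: S_def finite_frontier_ereal_interval)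
  ultimately have "finite V"
    by (meson finite_imageI finite_subset subsetI)
  moreover have "V \<noteq> {}"
    using c dom by blast
  ultimately obtain \<xi>' where "\<xi>' \<in> V" "\<forall>\<xi>\<in>V. F \<xi> \<le> F \<xi>'"
    using Max_in[of "F ` V"] Max_ge[of "F ` V"]
    by (metis (no_types, lifting) finite_imageI image_iff image_is_empty imageI)
  then show ?thesis
    using dom unfolding V_def by (smt (verit) mem_Collect_eq)
qed

subsection \<open>The second-stage value function\<close>

text \<open>The second-stage cost as a real function of the right-hand side alone. The real infimum
  is meaningful only over a nonempty set of costs that is bounded below; complete recourse and dual
  feasibility provide this.\<close>

definition recourse_value :: "(real ^ 'n) set \<Rightarrow> real ^ 'n \<Rightarrow> real ^ 'n ^ 'm \<Rightarrow> real ^ 'm \<Rightarrow> real" where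
  "recourse_value K q W r = (INF y \<in> {y \<in> K. W *v y \<ge> r}. q \<bullet> y)"

text \<open>Pair \<open>W *v y \<ge> r\<close> with \<open>\<pi> \<ge> 0\<close>, transpose
  \<open>W\<close>, and pair the dual cone condition with \<open>y\<close>.\<close>

lemma weak_duality:
  fixes W :: "real ^ 'n ^ 'm"
  assumes "\<pi> \<in> dual_feasible_set K q W" "y \<in> K" "W *v y \<ge> r"
  shows "r \<bullet> \<pi> \<le> q \<bullet> y"
proof -
  have "r \<bullet> \<pi> \<le> (W *v y) \<bullet> \<pi>"
    using assms
    by (auto simp: inner_vec_def dual_feasible_set_def less_eq_vec_def intro!: sum_mono mult_right_mono)
  also have "\<dots> = (transpose W *v \<pi>) \<bullet> y"
    using dot_lmul_matrix[of \<pi> W y] by (simp add: inner_commute)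
  also have "\<dots> \<le> q \<bullet> y"
    using assms by (auto simp: dual_feasible_set_def dual_cone_def inner_diff_left)
  finally show ?thesis .
qed

context
  fixes K :: "(real ^ 'n) set" and q :: "real ^ 'n" and W :: "real ^ 'n ^ 'm"
  assumes recourse: "complete_recourse K W" and dual: "dual_feasible_set K q W \<noteq> {}"
begin

text \<open>Any dual feasible \<open>\<pi>\<close> yields the lower bound
  \<open>r \<bullet> \<pi>\<close>.\<close>

lemma recourse_costs_bdd_below: "bdd_below ((\<bullet>) q ` {y \<in> K. W *v y \<ge> r})"
  using dual weak_duality by (fastforce intro: bdd_belowI)

lemma recourse_feasible_nonempty: "{y \<in> K. W *v y \<ge> r} \<noteq> {}"
  using recourse unfolding complete_recourse_def by blast

lemma second_stage_cost_eq_recourse_value: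
  "second_stage_cost K q W h T x \<xi> = ereal (recourse_value K q W (h x + T x *v \<xi>))"
  unfolding second_stage_cost_def recourse_value_def
  using recourse_costs_bdd_below recourse_feasible_nonempty
  by (subst ereal_Inf') (auto simp: image_image)

text \<open>A convex combination of feasible points for \<open>r\<close> and \<open>s\<close> is
  feasible for the same combination of \<open>r\<close> and \<open>s\<close>, and the cost is
  linear.\<close>

lemma convex_on_recourse_value:
  assumes "convex K"
  shows "convex_on UNIV (recourse_value K q W)"
proof (rule convex_onI)
  fix t :: real and r s :: "real ^ 'm"
  assume t: "0 < t" "t < 1"
  let ?v = "recourse_value K q W"
  show "?v ((1 - t) *\<^sub>R r + t *\<^sub>R s) \<le> (1 - t) * ?v r + t * ?v s"
  \<comment> \<open>The infima need not be attained, so near-optimal points are combined; the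
    weights sum to 1, so the total slack is again \<open>e\<close>.\<close>
  proof (rule field_le_epsilon)
    fix e :: real assume "e > 0"
    have near: "\<exists>y\<in>K. W *v y \<ge> r \<and> q \<bullet> y < ?v r + e" for r
      using cInf_lessD[of "(\<bullet>) q ` {y \<in> K. W *v y \<ge> r}" "?v r + e"]
        recourse_feasible_nonempty[of r] \<open>e > 0\<close>
      by (auto simp: recourse_value_def)
    obtain y z where y: "y \<in> K" "W *v y \<ge> r" "q \<bullet> y < ?v r + e"
      and z: "z \<in> K" "W *v z \<ge> s" "q \<bullet> z < ?v s + e"
      using near by meson
    let ?w = "(1 - t) *\<^sub>R y + t *\<^sub>R z"
    have "?w \<in> K"
      using assms y(1) z(1) t by (intro convexD) auto
    moreover have "W *v ?w \<ge> (1 - t) *\<^sub>R r + t *\<^sub>R s"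
      using y(2) z(2) t
      by (auto simp: matrix_vector_right_distrib matrix_vector_mult_scaleR less_eq_vec_def
          intro!: add_mono mult_left_mono)
    ultimately have "?v ((1 - t) *\<^sub>R r + t *\<^sub>R s) \<le> q \<bullet> ?w"
      unfolding recourse_value_def by (intro cINF_lower recourse_costs_bdd_below) auto
    also have "\<dots> = (1 - t) * (q \<bullet> y) + t * (q \<bullet> z)"
      by (simp add: inner_add_right)
    also have "\<dots> \<le> (1 - t) * (?v r + e) + t * (?v s + e)"
      using y(3) z(3) t by (intro add_mono mult_left_mono) auto
    also have "\<dots> = (1 - t) * ?v r + t * ?v s + e"
      by (simp add: algebra_simps)
    finally show "?v ((1 - t) *\<^sub>R r + t *\<^sub>R s) \<le> (1 - t) * ?v r + t * ?v s + e" .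
  qed
qed simp

end

text \<open>\<open>K\<close> is an intersection of preimages of convex cones under linear coordinate
  projections.\<close>

lemma product_of_proper_cones_imp_convex:
  assumes "product_of_proper_cones K"
  shows "convex K"
proof -
  obtain P C where C: "\<And>B. B \<in> P \<Longrightarrow> convex (C B)"
    and K: "K = {y. \<forall>B\<in>P. coord_proj B y \<in> C B}"
    using assms unfolding product_of_proper_cones_def proper_cone_in_def by blast
  have "linear (coord_proj B)" for B :: "'a set"
    by (rule linearI) (auto simp: coord_proj_def vec_eq_iff)
  then have "convex (coord_proj B -` C B)" if "B \<in> P" for B
    using C that by (intro convex_linear_vimage)
  then have "convex (\<Inter>B\<in>P. coord_proj B -` C B)"
    by (intro convex_INT)
  moreover have "(\<Inter>B\<in>P. coord_proj B -` C B) = K"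
    by (auto simp: K)
  ultimately show ?thesis by simp
qed

section \<open>The penalised objective along one coordinate\<close>

theorem proposition3p5:
  fixes K :: "(real ^ 'ny) set"
    and q :: "real ^ 'ny"
    and W :: "real ^ 'ny ^ 'my"
    and h :: "real ^ 'nx \<Rightarrow> real ^ 'my"
    and T :: "real ^ 'nx \<Rightarrow> real ^ 'k ^ 'my"
    and l u :: "'k \<Rightarrow> ereal"
    and \<Xi> :: "(real ^ 'k) set"
    and x :: "real ^ 'nx"
    and \<zeta> :: "nat \<Rightarrow> real ^ 'k"
    and N i :: nat
    and lam :: real
  assumes "product_of_proper_cones K"
    and "affine_map h" and "affine_map T"
    and "complete_recourse K W"
    and "dual_strict_feasibility K q W"
    and "\<Xi> = box_set l u"
    and "\<Xi> \<noteq> {}" and "closed \<Xi>" and "convex \<Xi>"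
    and "\<forall>n\<in>{1..N}. \<zeta> n \<in> \<Xi>"
    and "lam \<ge> 0"
    and "i \<in> {1..N}"
    and finite_optimum:
      "\<bar>SUP \<xi>\<in>\<Xi>. second_stage_cost K q W h T x \<xi> - ereal (lam * l1_norm (\<xi> - \<zeta> i))\<bar> \<noteq> \<infinity>"
  shows "\<exists>\<xi>'\<in>\<Xi>.
      (\<forall>\<xi>\<in>\<Xi>. second_stage_cost K q W h T x \<xi> - ereal (lam * l1_norm (\<xi> - \<zeta> i))
            \<le> second_stage_cost K q W h T x \<xi>' - ereal (lam * l1_norm (\<xi>' - \<zeta> i))) \<and>
      (\<forall>j. \<xi>' $ j \<in> frontier {t::real. l j \<le> ereal t \<and> ereal t \<le> u j} \<or> \<xi>' $ j = \<zeta> i $ j)"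
proof -
  let ?v = "recourse_value K q W"
  define F where "F \<xi> = ?v (h x + T x *v \<xi>) - lam * l1_norm (\<xi> - \<zeta> i)" for \<xi>
  note dual = assms(5)[unfolded dual_strict_feasibility_def, THEN conjunct1]
  have cost: "second_stage_cost K q W h T x \<xi> - ereal (lam * l1_norm (\<xi> - \<zeta> i)) = ereal (F \<xi>)" for \<xi>
    by (simp add: second_stage_cost_eq_recourse_value[OF assms(4) dual] F_def)
  have v: "convex_on UNIV ?v"
    using convex_on_recourse_value[OF assms(4) dual] product_of_proper_cones_imp_convex assms(1)
    by blast
  have \<zeta>: "\<zeta> i \<in> box_set l u"
    using assms(6,10,12) by blast
  \<comment> \<open>The finite optimum serves as an upper bound for \<open>F\<close> on the box;
    this excludes growth along unbounded directions.\<close>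
  obtain M where "(SUP \<xi>\<in>\<Xi>. ereal (F \<xi>)) = ereal M"
    using finite_optimum unfolding cost by (metis ereal_infinity_cases ereal_real')
  then have "F \<xi> \<le> M" if "\<xi> \<in> \<Xi>" for \<xi>
    using SUP_upper[OF that, of "\<lambda>\<xi>. ereal (F \<xi>)"] by simp
  then have bdd: "bdd_above (F ` box_set l u)"
    using assms(6) by (intro bdd_aboveI2[of _ F M]) simp
  \<comment> \<open>The sign \<open>\<sigma>\<close> covers both sides of the kink at once: where
    the absolute value is \<open>\<sigma>\<close> times its argument, the penalty is affine in
    \<open>t\<close>, so subtracting it preserves convexity.\<close>
  have conv: "convex_on A (\<lambda>t. F (\<chi> k. if k = j then t else \<xi> $ k))"
    if "convex A" and abs: "\<And>t. t \<in> A \<Longrightarrow> \<bar>t - \<zeta> i $ j\<bar> = \<sigma> * (t - \<zeta> i $ j)" for A j \<xi> \<sigma>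
  proof -
    define upd where "upd t = (\<chi> k. if k = j then t else \<xi> $ k)" for t
    \<comment> \<open>The share of the other coordinates in the norm, constant in
      \<open>t\<close>.\<close>
    define R where "R = (\<Sum>k\<in>UNIV - {j}. \<bar>\<xi> $ k - \<zeta> i $ k\<bar>)"
    have upd: "upd ((1 - t) *\<^sub>R a + t *\<^sub>R b) = (1 - t) *\<^sub>R upd a + t *\<^sub>R upd b" for t a b
      by (simp add: upd_def vec_eq_iff algebra_simps)
    have "h x + T x *v upd ((1 - t) *\<^sub>R a + t *\<^sub>R b)
      = (1 - t) *\<^sub>R (h x + T x *v upd a) + t *\<^sub>R (h x + T x *v upd b)" for t a b
      unfolding upd by (simp add: matrix_vector_right_distrib matrix_vector_mult_scaleR algebra_simps)
    then have "convex_on A (\<lambda>t. ?v (h x + T x *v upd t))"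
      by (rule convex_on_compose_affine_combination[OF v \<open>convex A\<close>])
    moreover have "convex_on A (\<lambda>t. - lam * (\<sigma> * (t - \<zeta> i $ j) + R))"
    proof (rule convex_onI)
      show "- lam * (\<sigma> * ((1 - t) *\<^sub>R a + t *\<^sub>R b - \<zeta> i $ j) + R)
        \<le> (1 - t) * (- lam * (\<sigma> * (a - \<zeta> i $ j) + R)) + t * (- lam * (\<sigma> * (b - \<zeta> i $ j) + R))" for t a b
        by (rule eq_refl, unfold real_scaleR_def) algebra
    qed fact
    ultimately have sum: "convex_on A (\<lambda>t. ?v (h x + T x *v upd t) + - lam * (\<sigma> * (t - \<zeta> i $ j) + R))"
      by (rule convex_on_add)
    have l1: "l1_norm (upd t - \<zeta> i) = \<sigma> * (t - \<zeta> i $ j) + R" if "t \<in> A" for t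
      using abs[OF that]
      by (simp add: l1_norm_def R_def sum.remove[of UNIV j] upd_def cong: sum.cong_simp)
    have "convex_on A (\<lambda>t. F (upd t))"
      using sum by (rule convex_on_eq) (simp add: F_def l1)
    then show ?thesis
      unfolding upd_def .
  qed
  have right: "convex_on {\<zeta> i $ j..} (\<lambda>t. F (\<chi> k. if k = j then t else \<xi> $ k))" for j \<xi>
    by (rule conv[where \<sigma> = 1]) auto
  have left: "convex_on {..\<zeta> i $ j} (\<lambda>t. F (\<chi> k. if k = j then t else \<xi> $ k))" for j \<xi>
    by (rule conv[where \<sigma> = "- 1"]) auto
  show ?thesis
    unfolding cost \<open>\<Xi> = box_set l u\<close> ereal_less_eq
    by (rule coordinatewise_convex_box_maximum[OF \<zeta> bdd right left])
qed

end
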